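(* Let $G$ be the incidence graph of a $\mathrm{BIBD}(v,b,r,k,1)$ with $r = k+1$ and $k \ge 3$. Then $\zeta(G) \le k+1$.
   Context: A $\mathrm{BIBD}(v,b,r,k,\lambda)$ is a set $X$ of $v$ points together with a collection $\mathcal{B}$ of $b$ blocks (subsets of $X$) such that every block has size $k$, every point lies in exactly $r$ blocks, and every pair of distinct points lies in exactly $\lambda$ blocks. Its incidence graph is the bipartite graph on $X \cup \mathcal{B}$ with $x \sim B$ iff $x \in B$. Localization game on a connected graph $G$ with $k$ cops: the robber chooses a starting vertex, invisible to the cops. Each round the cops choose any $k$ vertices (no adjacency restriction) and each learns its distance to the robber; the cops win if after finitely many rounds they determine the robber's vertex uniquely; otherwise the robber moves to a neighbour or stays. The robber knows the cops' strategy. $\zeta(G)$ is the least $k$ for which $k$ cops can guarantee capture. *)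

theory Defs
  imports "Graph_Theory.Pair_Digraph" "HOL-Library.Extended_Nat"
begin

text \<open>The blocks form a set rather than a multiset: for \<open>l = 1\<close> and \<open>k \<ge> 2\<close> no block
  can be repeated, since two of its points would lie in two blocks.\<close>

definition bibd ::
  "'a set \<Rightarrow> 'a set set \<Rightarrow> nat \<Rightarrow> nat \<Rightarrow> nat \<Rightarrow> nat \<Rightarrow> nat \<Rightarrow> bool" where
  "bibd X \<B> v b r k l \<longleftrightarrow>
     finite X \<and> card X = v \<and>
     finite \<B> \<and> card \<B> = b \<and>
     (\<forall>B\<in>\<B>. B \<subseteq> X \<and> card B = k) \<and>
     (\<forall>x\<in>X. card {B \<in> \<B>. x \<in> B} = r) \<and>
     (\<forall>x\<in>X. \<forall>y\<in>X. x \<noteq> y \<longrightarrow> card {B \<in> \<B>. x \<in> B \<and> y \<in> B} = l)"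

text \<open>Undirected graphs are represented by digraphs with a symmetric set of arcs.\<close>

definition incidence_graph :: "'a set \<Rightarrow> 'a set set \<Rightarrow> ('a + 'a set) pair_pre_digraph" where
  "incidence_graph X \<B> =
     \<lparr> pverts = Inl ` X \<union> Inr ` \<B>,
       parcs = {(Inl x, Inr B) | x B. x \<in> X \<and> B \<in> \<B> \<and> x \<in> B}
             \<union> {(Inr B, Inl x) | x B. x \<in> X \<and> B \<in> \<B> \<and> x \<in> B} \<rparr>"

lemma pair_graph_incidence_graph:
  assumes "finite X" and "finite \<B>"
  shows "pair_graph (incidence_graph X \<B>)"
proof
  let ?G = "incidence_graph X \<B>"
  show fst: "fst e \<in> pverts ?G" and snd: "snd e \<in> pverts ?G" if "e \<in> parcs ?G" for e
    using that by (auto simp: incidence_graph_def)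
  show fin: "finite (pverts ?G)"
    using assms by (simp add: incidence_graph_def)
  have "parcs ?G \<subseteq> pverts ?G \<times> pverts ?G"
    using fst snd by (auto simp: mem_Times_iff)
  then show "finite (parcs ?G)"
    using fin by (meson finite_SigmaI finite_subset)
  show "fst e \<noteq> snd e" if "e \<in> parcs ?G" for e
    using that by (auto simp: incidence_graph_def)
  show "symmetric (with_proj ?G)"
    by (auto simp: symmetric_def sym_def incidence_graph_def)
qed

definition graph_dist :: "'a pair_pre_digraph \<Rightarrow> 'a \<Rightarrow> 'a \<Rightarrow> enat" where
  "graph_dist G u w = (INF p \<in> {p. pre_digraph.awalk (with_proj G) u p w}. enat (length p))"

text \<open>\<open>w n\<close> is the robber's position when the cops probe in round \<open>n\<close>, counting from \<open>0\<close>.\<close>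

definition robber_walk :: "'a pair_pre_digraph \<Rightarrow> (nat \<Rightarrow> 'a) \<Rightarrow> bool" where
  "robber_walk G w \<longleftrightarrow>
     w 0 \<in> pverts G \<and> (\<forall>n. w (Suc n) = w n \<or> (w n, w (Suc n)) \<in> parcs G)"

text \<open>A strategy maps the answers of all previous rounds (one list of distances per round)
  to the vertices probed next. The earlier probes need not be recorded, as the strategy
  determines them from the answers.\<close>

type_synonym 'a cop_strategy = "enat list list \<Rightarrow> 'a list"

text \<open>The answers obtained in the first \<open>n\<close> rounds against the robber \<open>w\<close>.\<close>

primrec answers ::
  "'a pair_pre_digraph \<Rightarrow> 'a cop_strategy \<Rightarrow> (nat \<Rightarrow> 'a) \<Rightarrow> nat \<Rightarrow> enat list list" where
  "answers G \<sigma> w 0 = []"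
| "answers G \<sigma> w (Suc n) =
     answers G \<sigma> w n @ [map (\<lambda>c. graph_dist G c (w n)) (\<sigma> (answers G \<sigma> w n))]"

text \<open>The robber \<open>w\<close> is located in round \<open>n\<close> if every robber that has produced the same
  answers up to and including that round is now at the same vertex. Quantifying over all \<open>w\<close>
  accounts for a robber who knows the strategy.\<close>

definition winning_strategy :: "'a pair_pre_digraph \<Rightarrow> nat \<Rightarrow> 'a cop_strategy \<Rightarrow> bool" where
  "winning_strategy G m \<sigma> \<longleftrightarrow>
     (\<forall>h. length (\<sigma> h) = m \<and> set (\<sigma> h) \<subseteq> pverts G) \<and>
     (\<forall>w. robber_walk G w \<longrightarrow>
        (\<exists>n. \<forall>w'. robber_walk G w' \<and> answers G \<sigma> w' (Suc n) = answers G \<sigma> w (Suc n)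
                \<longrightarrow> w' n = w n))"

text \<open>The infimum is the least number of cops that suffices, or \<open>\<infinity>\<close> if no finite number does.\<close>

definition localization_number :: "'a pair_pre_digraph \<Rightarrow> enat" where
  "localization_number G = (INF m \<in> {m. \<exists>\<sigma>. winning_strategy G m \<sigma>}. enat m)"

end

theory Submission
  imports Defs
begin

text \<open>The design is an affine plane of order \<open>k\<close>. The distances from a probed line reveal incidence
  with points and equality or parallelism with lines; distances from a probed point reveal equality
  and incidence. Given \<open>s \<le> k\<close> candidate points, the cops probe them together with \<open>k + 1 - s\<close>
  lines of different directions: unless located, a robber who has moved to a line is then on one
  of at most \<open>s\<close> lines through a known point. Given \<open>t \<le> k\<close> concurrent candidate lines, the cops
  probe them together with \<open>k + 1 - t\<close> lines of another parallel class: unless located, a robber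
  who has moved to a point is then at one of at most \<open>t - 1\<close> points. So the number of candidates
  decreases until the robber is located. To get started, probing all lines through a point
  confines the robber to the \<open>k\<close> points of a line or to a parallel class, and in the latter case
  probing that class locates the robber or confines it to the points of a line.\<close>

section \<open>Candidate sets and winning strategies\<close>

definition closed_nbhd :: "'a pair_pre_digraph \<Rightarrow> 'a set \<Rightarrow> 'a set" where
  "closed_nbhd G R = R \<union> {u. \<exists>r\<in>R. (r, u) \<in> parcs G}"

definition probe_answer :: "'a pair_pre_digraph \<Rightarrow> 'a list \<Rightarrow> 'a \<Rightarrow> enat list" where
  "probe_answer G c u = map (\<lambda>d. graph_dist G d u) c"

text \<open>\<open>R\<close> is the set of positions that the answers heard so far leave possible, before the robber
  makes the next move.\<close>

inductive cops_win :: "'a pair_pre_digraph \<Rightarrow> nat \<Rightarrow> 'a set \<Rightarrow> bool" for G m where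
  located: "R \<subseteq> {u} \<Longrightarrow> cops_win G m R"
| probe: "length c = m \<Longrightarrow> set c \<subseteq> pverts G \<Longrightarrow>
    (\<And>a. cops_win G m {u \<in> closed_nbhd G R. probe_answer G c u = a}) \<Longrightarrow> cops_win G m R"

lemma cops_win_empty [simp]: "cops_win G m {}"
  by (rule cops_win.located) simp

lemma cops_win_singleton [simp]: "cops_win G m {u}"
  by (rule cops_win.located) simp

lemma closed_nbhd_mono: "R \<subseteq> R' \<Longrightarrow> closed_nbhd G R \<subseteq> closed_nbhd G R'"
  by (auto simp: closed_nbhd_def)

lemma cops_win_mono: "cops_win G m R' \<Longrightarrow> R \<subseteq> R' \<Longrightarrow> cops_win G m R"
proof (induction arbitrary: R rule: cops_win.induct)
  case (located R' u)
  then show ?case by (simp add: cops_win.located[of R u])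
next
  case (probe c R')
  show ?case
  proof (rule cops_win.probe)
    show "cops_win G m {u \<in> closed_nbhd G R. probe_answer G c u = a}" for a
      by (rule probe.IH[of _ a]) (use closed_nbhd_mono[OF probe.prems] in blast)
  qed (use probe.hyps in auto)
qed

definition unresolved :: "'a pair_pre_digraph \<Rightarrow> 'a set \<Rightarrow> 'a \<Rightarrow> 'a set" where
  "unresolved G C u = {u'. \<forall>d\<in>C. graph_dist G d u' = graph_dist G d u}"

lemma cops_win_probe_set:
  assumes C: "finite C" "C \<noteq> {}" "card C \<le> m" "C \<subseteq> pverts G"
    and win: "\<And>u. u \<in> closed_nbhd G R \<Longrightarrow> cops_win G m (closed_nbhd G R \<inter> unresolved G C u)"
  shows "cops_win G m R"
proof -
  obtain cs where cs: "set cs = C" "distinct cs"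
    using finite_distinct_list C(1) by blast
  then have "length cs \<le> m" "cs \<noteq> []"
    using C(2,3) distinct_card by force+
  define c where "c = cs @ replicate (m - length cs) (hd cs)"
  have c: "length c = m" "set c = C"
    using cs \<open>length cs \<le> m\<close> \<open>cs \<noteq> []\<close> by (auto simp: c_def)
  have "cops_win G m {u \<in> closed_nbhd G R. probe_answer G c u = a}" (is "cops_win G m ?Q") for a
  proof (cases "?Q = {}")
    case True
    show ?thesis unfolding True by simp
  next
    case False
    then obtain u where u: "u \<in> closed_nbhd G R" "probe_answer G c u = a" by blast
    then have "?Q \<subseteq> closed_nbhd G R \<inter> unresolved G C u"
      using c(2) by (auto simp: unresolved_def probe_answer_def)
    then show ?thesis by (rule cops_win_mono[OF win[OF u(1)]])
  qed
  then show ?thesis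
    using c C(4) by (metis cops_win.probe)
qed

definition legal_strategy :: "'a pair_pre_digraph \<Rightarrow> nat \<Rightarrow> 'a cop_strategy \<Rightarrow> bool" where
  "legal_strategy G m \<sigma> \<longleftrightarrow> (\<forall>h. length (\<sigma> h) = m \<and> set (\<sigma> h) \<subseteq> pverts G)"

definition walks_from :: "'a pair_pre_digraph \<Rightarrow> 'a set \<Rightarrow> (nat \<Rightarrow> 'a) set" where
  "walks_from G R = {w. w 0 \<in> R \<and> (\<forall>n. w (Suc n) = w n \<or> (w n, w (Suc n)) \<in> parcs G)}"

text \<open>The robber starts in \<open>R\<close> and moves before the first probe, so the probes see \<open>w \<circ> Suc\<close>.\<close>

definition locates_from :: "'a pair_pre_digraph \<Rightarrow> 'a cop_strategy \<Rightarrow> 'a set \<Rightarrow> bool" where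
  "locates_from G \<sigma> R \<longleftrightarrow> (\<forall>w\<in>walks_from G R. \<exists>n. \<forall>w'\<in>walks_from G R.
     answers G \<sigma> (w' \<circ> Suc) n = answers G \<sigma> (w \<circ> Suc) n \<longrightarrow> w' n = w n)"

lemma answers_case_list:
  "answers G (case_list c \<tau>) w (Suc n) =
     probe_answer G c (w 0) # answers G (\<tau> (probe_answer G c (w 0))) (w \<circ> Suc) n"
  by (induction n) (simp_all add: probe_answer_def)

lemma walks_from_shift:
  assumes "w \<in> walks_from G R" "probe_answer G c (w (Suc 0)) = a"
  shows "w \<circ> Suc \<in> walks_from G {u \<in> closed_nbhd G R. probe_answer G c u = a}"
proof -
  have step: "w (Suc n) = w n \<or> (w n, w (Suc n)) \<in> parcs G" for n
    using assms(1) by (simp add: walks_from_def)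
  moreover have "w (Suc 0) \<in> closed_nbhd G R"
    using step[of 0] assms(1)
    by (cases "w (Suc 0) = w 0") (auto simp: closed_nbhd_def walks_from_def)
  ultimately show ?thesis
    using assms(2) by (simp add: walks_from_def)
qed

lemma locates_from_case_list:
  assumes \<tau>: "\<And>a. locates_from G (\<tau> a) {u \<in> closed_nbhd G R. probe_answer G c u = a}"
  shows "locates_from G (case_list c \<tau>) R"
  unfolding locates_from_def
proof
  fix w assume w: "w \<in> walks_from G R"
  define a where "a = probe_answer G c (w (Suc 0))"
  let ?Q = "{u \<in> closed_nbhd G R. probe_answer G c u = a}"
  have "w \<circ> Suc \<in> walks_from G ?Q"
    using walks_from_shift[OF w] a_def by blast
  then obtain n where n: "\<And>v. v \<in> walks_from G ?Q \<Longrightarrow>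
      answers G (\<tau> a) (v \<circ> Suc) n = answers G (\<tau> a) (w \<circ> Suc \<circ> Suc) n \<Longrightarrow> v n = (w \<circ> Suc) n"
    using \<tau>[of a] unfolding locates_from_def by blast
  have "w' (Suc n) = w (Suc n)"
    if w': "w' \<in> walks_from G R"
      and eq: "answers G (case_list c \<tau>) (w' \<circ> Suc) (Suc n) =
        answers G (case_list c \<tau>) (w \<circ> Suc) (Suc n)" for w'
  proof -
    have "probe_answer G c (w' (Suc 0)) = a"
      and rest: "answers G (\<tau> a) (w' \<circ> Suc \<circ> Suc) n = answers G (\<tau> a) (w \<circ> Suc \<circ> Suc) n"
      using eq unfolding answers_case_list by (auto simp: a_def)
    then have "w' \<circ> Suc \<in> walks_from G ?Q"
      by (intro walks_from_shift[OF w'])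
    then show ?thesis using n[OF _ rest] by simp
  qed
  then show "\<exists>n. \<forall>w'\<in>walks_from G R. answers G (case_list c \<tau>) (w' \<circ> Suc) n =
      answers G (case_list c \<tau>) (w \<circ> Suc) n \<longrightarrow> w' n = w n"
    by blast
qed

lemma cops_win_imp_strategy:
  assumes "cops_win G m R" "pverts G \<noteq> {}"
  shows "\<exists>\<sigma>. legal_strategy G m \<sigma> \<and> locates_from G \<sigma> R"
  using assms(1)
proof induction
  case (located R u)
  obtain x where "x \<in> pverts G" using assms(2) by blast
  then have "legal_strategy G m (\<lambda>_. replicate m x)"
    by (auto simp: legal_strategy_def)
  moreover have "locates_from G \<sigma> R" for \<sigma>
    unfolding locates_from_def walks_from_def using located by (intro ballI exI[of _ 0]) auto
  ultimately show ?case by blast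
next
  case (probe c R)
  obtain \<tau> where \<tau>: "\<And>a. legal_strategy G m (\<tau> a)"
    "\<And>a. locates_from G (\<tau> a) {u \<in> closed_nbhd G R. probe_answer G c u = a}"
    using probe.IH by metis
  have "legal_strategy G m (case_list c \<tau>)"
    using probe.hyps \<tau>(1) by (simp add: legal_strategy_def split: list.split)
  then show ?case using locates_from_case_list[OF \<tau>(2)] by blast
qed

lemma winning_strategy_if_locates_from:
  assumes "legal_strategy G m \<sigma>" "locates_from G \<sigma> (pverts G)"
  shows "winning_strategy G m \<sigma>"
  unfolding winning_strategy_def
proof (intro conjI allI impI)
  show "length (\<sigma> h) = m" "set (\<sigma> h) \<subseteq> pverts G" for h
    using assms(1) by (simp_all add: legal_strategy_def)
next
  fix w assume w: "robber_walk G w"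
  have wait: "case_nat (v 0) v \<in> walks_from G (pverts G)" "case_nat (v 0) v \<circ> Suc = v"
    if "robber_walk G v" for v
    using that by (auto simp: walks_from_def robber_walk_def split: nat.split)
  obtain n where "\<And>v. v \<in> walks_from G (pverts G) \<Longrightarrow>
      answers G \<sigma> (v \<circ> Suc) n = answers G \<sigma> (case_nat (w 0) w \<circ> Suc) n \<Longrightarrow> v n = case_nat (w 0) w n"
    using assms(2) wait(1)[OF w] unfolding locates_from_def by blast
  then have n: "case_nat (w' 0) w' n = case_nat (w 0) w n"
    if "robber_walk G w'" "answers G \<sigma> w' n = answers G \<sigma> w n" for w'
    using wait[OF that(1)] wait(2)[OF w] that(2) by simp
  show "\<exists>n. \<forall>w'. robber_walk G w' \<and> answers G \<sigma> w' (Suc n) = answers G \<sigma> w (Suc n) \<longrightarrow>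
      w' n = w n"
  proof (cases n)
    case 0
    then show ?thesis using n by (intro exI[of _ 0]) simp
  next
    case (Suc j)
    then show ?thesis using n by (intro exI[of _ j]) (simp del: answers.simps)
  qed
qed

lemma localization_number_le_if_cops_win:
  assumes "cops_win G m (pverts G)"
  shows "localization_number G \<le> enat m"
proof (cases "pverts G = {}")
  case True
  then have "winning_strategy G 0 (\<lambda>_. [])"
    by (simp add: winning_strategy_def robber_walk_def)
  then have "localization_number G \<le> enat 0"
    unfolding localization_number_def by (intro INF_lower) auto
  then show ?thesis by (rule order_trans) simp
next
  case False
  then obtain \<sigma> where "winning_strategy G m \<sigma>"
    using cops_win_imp_strategy[OF assms] winning_strategy_if_locates_from by blast
  then show ?thesis
    unfolding localization_number_def by (intro INF_lower) auto
qed

section \<open>Linear spaces\<close>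

definition parallel :: "'a set \<Rightarrow> 'a set \<Rightarrow> bool" (infix "\<parallel>" 50) where
  "l \<parallel> m \<longleftrightarrow> l = m \<or> l \<inter> m = {}"

lemma parallel_refl [simp]: "l \<parallel> l"
  by (simp add: parallel_def)

lemma parallel_sym: "l \<parallel> m \<Longrightarrow> m \<parallel> l"
  by (auto simp: parallel_def)

lemma parallel_eqI: "l \<parallel> m \<Longrightarrow> x \<in> l \<Longrightarrow> x \<in> m \<Longrightarrow> l = m"
  by (auto simp: parallel_def)

locale linear_space =
  fixes X :: "'a set" and \<B> :: "'a set set"
  assumes block_subset: "l \<in> \<B> \<Longrightarrow> l \<subseteq> X"
    and block_nonempty: "l \<in> \<B> \<Longrightarrow> l \<noteq> {}"
    and ex_join: "x \<in> X \<Longrightarrow> y \<in> X \<Longrightarrow> \<exists>l\<in>\<B>. x \<in> l \<and> y \<in> l"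
    and join_unique: "l \<in> \<B> \<Longrightarrow> m \<in> \<B> \<Longrightarrow> x \<in> l \<Longrightarrow> y \<in> l \<Longrightarrow> x \<in> m \<Longrightarrow> y \<in> m \<Longrightarrow>
      x \<noteq> y \<Longrightarrow> l = m"
begin

definition pencil :: "'a \<Rightarrow> 'a set set" where
  "pencil x = {l \<in> \<B>. x \<in> l}"

definition parallel_class :: "'a set \<Rightarrow> 'a set set" where
  "parallel_class l = {m \<in> \<B>. l \<parallel> m}"

lemma pencil_not_parallel: "l \<in> pencil x \<Longrightarrow> m \<in> pencil x \<Longrightarrow> l \<noteq> m \<Longrightarrow> \<not> l \<parallel> m"
  by (auto simp: pencil_def parallel_def)

lemma card_pencil_meeting:
  assumes l: "l \<in> \<B>" and x: "x \<in> X" "x \<notin> l"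
  shows "card {m \<in> pencil x. \<not> l \<parallel> m} = card l"
proof -
  let ?M = "{m \<in> pencil x. \<not> l \<parallel> m}"
  have "\<forall>m\<in>?M. \<exists>y. y \<in> l \<and> y \<in> m"
    by (auto simp: parallel_def)
  from bchoice[OF this] obtain p
    where p: "\<And>m. m \<in> ?M \<Longrightarrow> p m \<in> l" "\<And>m. m \<in> ?M \<Longrightarrow> p m \<in> m"
    by blast
  have "bij_betw p ?M l"
  proof (rule bij_betwI')
    show "p m = p n \<longleftrightarrow> m = n" if mn: "m \<in> ?M" "n \<in> ?M" for m n
    proof
      assume eq: "p m = p n"
      have "p m \<noteq> x" using p(1)[OF mn(1)] x(2) by blast
      then show "m = n"
        using join_unique[of m n "p m" x] mn p(2)[OF mn(1)] p(2)[OF mn(2)] eq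
        by (simp add: pencil_def)
    qed simp
    show "p m \<in> l" if "m \<in> ?M" for m using p(1)[OF that] .
    show "\<exists>m\<in>?M. y = p m" if y: "y \<in> l" for y
    proof -
      obtain m where m: "m \<in> \<B>" "x \<in> m" "y \<in> m"
        using ex_join[OF x(1)] y block_subset[OF l] by blast
      then have "m \<noteq> l" "m \<in> ?M" using x(2) y by (auto simp: pencil_def parallel_def)
      then have "y = p m" using join_unique[of l m y "p m"] l m y p[of m] by blast
      then show ?thesis using \<open>m \<in> ?M\<close> by blast
    qed
  qed
  then show ?thesis by (rule bij_betw_same_card)
qed

lemma card_block_Int_Union_parallels:
  assumes m: "m \<in> \<B>" and N: "N \<subseteq> \<B>" "pairwise (\<parallel>) N" "\<And>n. n \<in> N \<Longrightarrow> \<not> m \<parallel> n"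
  shows "card (m \<inter> \<Union>N) = card N"
proof -
  have "\<forall>n\<in>N. \<exists>x. x \<in> m \<and> x \<in> n"
    using N(3) by (auto simp: parallel_def)
  from bchoice[OF this] obtain p
    where p: "\<And>n. n \<in> N \<Longrightarrow> p n \<in> m" "\<And>n. n \<in> N \<Longrightarrow> p n \<in> n"
    by blast
  have "inj_on p N"
  proof (rule inj_onI)
    fix n n' assume "n \<in> N" "n' \<in> N" "p n = p n'"
    then show "n = n'"
      using p(2)[of n] p(2)[of n'] parallel_eqI[of n n' "p n"] N(2) by (auto simp: pairwise_def)
  qed
  moreover have "p ` N = m \<inter> \<Union>N"
  proof
    show "p ` N \<subseteq> m \<inter> \<Union>N" using p by blast
    show "m \<inter> \<Union>N \<subseteq> p ` N"
    proof
      fix x assume "x \<in> m \<inter> \<Union>N"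
      then obtain n where n: "n \<in> N" "x \<in> m" "x \<in> n" by blast
      then have "m \<noteq> n" using N(3)[of n] by auto
      then have "x = p n" using join_unique[of m n x "p n"] m n N(1) p[of n] by blast
      then show "x \<in> p ` N" using n(1) by blast
    qed
  qed
  ultimately show ?thesis by (metis card_image)
qed

end

section \<open>Distances in the incidence graph\<close>

lemma (in pair_wf_digraph) awalk_imp_relpow:
  "awalk u p w \<Longrightarrow> (u, w) \<in> parcs G ^^ length p"
proof (induction p arbitrary: u)
  case Nil
  then show ?case by (simp add: awalk_Nil_iff)
next
  case (Cons e p)
  then have "(u, snd e) \<in> parcs G" "(snd e, w) \<in> parcs G ^^ length p"
    by (auto simp: awalk_Cons_iff)
  then have "(u, w) \<in> parcs G ^^ Suc (length p)" by (rule relpow_Suc_I2)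
  then show ?case by simp
qed

lemma (in pair_wf_digraph) relpow_imp_awalk:
  "u \<in> pverts G \<Longrightarrow> (u, w) \<in> parcs G ^^ n \<Longrightarrow> \<exists>p. awalk u p w \<and> length p = n"
proof (induction n arbitrary: u)
  case 0
  then show ?case by (simp add: awalk_Nil_iff)
next
  case (Suc n)
  obtain v where v: "(u, v) \<in> parcs G" "(v, w) \<in> parcs G ^^ n"
    using Suc.prems(2) by (rule relpow_Suc_E2)
  moreover have "v \<in> pverts G" using arc_snd_in_verts[OF v(1)] by simp
  ultimately obtain p where "awalk v p w" "length p = n" using Suc.IH by blast
  then have "awalk u ((u, v) # p) w \<and> length ((u, v) # p) = Suc n"
    using v(1) by (simp add: awalk_Cons_iff)
  then show ?case by blast
qed

lemma (in pair_wf_digraph) graph_dist_eqI: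
  assumes "u \<in> pverts G" "(u, w) \<in> parcs G ^^ n" "\<And>i. i < n \<Longrightarrow> (u, w) \<notin> parcs G ^^ i"
  shows "graph_dist G u w = enat n"
  unfolding graph_dist_def
proof (rule antisym)
  obtain p where "awalk u p w" "length p = n"
    using relpow_imp_awalk[OF assms(1,2)] by blast
  then show "(INF p\<in>{p. awalk u p w}. enat (length p)) \<le> enat n"
    by (intro INF_lower2[of p]) auto
  have "n \<le> length q" if "awalk u q w" for q
    using awalk_imp_relpow[OF that] assms(3) not_le by blast
  then show "enat n \<le> (INF p\<in>{p. awalk u p w}. enat (length p))"
    by (intro INF_greatest) simp
qed

context linear_space
begin

abbreviation G :: "('a + 'a set) pair_pre_digraph" where
  "G \<equiv> incidence_graph X \<B>"

lemma parcs_simps [simp]: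
  "(Inl x, Inr l) \<in> parcs G \<longleftrightarrow> l \<in> \<B> \<and> x \<in> l"
  "(Inr l, Inl x) \<in> parcs G \<longleftrightarrow> l \<in> \<B> \<and> x \<in> l"
  "(Inl x, Inl y) \<notin> parcs G"
  "(Inr l, Inr m) \<notin> parcs G"
  using block_subset by (auto simp: incidence_graph_def)

lemma pverts_simps [simp]:
  "Inl x \<in> pverts G \<longleftrightarrow> x \<in> X"
  "Inr l \<in> pverts G \<longleftrightarrow> l \<in> \<B>"
  by (auto simp: incidence_graph_def)

lemma pair_wf_digraph_incidence_graph: "pair_wf_digraph G"
  by unfold_locales (auto simp: incidence_graph_def)

lemma relpow_parcs_parity: "(u, w) \<in> parcs G ^^ n \<Longrightarrow> even n \<longleftrightarrow> (isl u \<longleftrightarrow> isl w)"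
proof (induction n arbitrary: w)
  case 0
  then show ?case by simp
next
  case (Suc n)
  then obtain v where v: "(u, v) \<in> parcs G ^^ n" "(v, w) \<in> parcs G" by auto
  then have "isl v \<noteq> isl w" by (cases v; cases w) auto
  then show ?case using Suc.IH[OF v(1)] by auto
qed

lemma graph_dist_parityI:
  assumes "u \<in> pverts G" "(u, w) \<in> parcs G ^^ n"
    and shorter: "\<And>i. i < n \<Longrightarrow> even i \<longleftrightarrow> even n \<Longrightarrow> (u, w) \<notin> parcs G ^^ i"
  shows "graph_dist G u w = enat n"
proof (rule pair_wf_digraph.graph_dist_eqI[OF pair_wf_digraph_incidence_graph assms(1,2)])
  show "(u, w) \<notin> parcs G ^^ i" if "i < n" for i
    using shorter[OF that] relpow_parcs_parity[of u w i] relpow_parcs_parity[OF assms(2)] by blast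
qed

lemma graph_dist_self: "u \<in> pverts G \<Longrightarrow> graph_dist G u u = enat 0"
  by (rule graph_dist_parityI) simp_all

lemma points_relpow_2:
  assumes "x \<in> X" "y \<in> X"
  shows "(Inl x, Inl y) \<in> parcs G ^^ 2"
proof -
  obtain l where "l \<in> \<B>" "x \<in> l" "y \<in> l" using ex_join assms by blast
  then show ?thesis by (auto simp: numeral_2_eq_2 intro: relcompI[of _ "Inr l"])
qed

lemma graph_dist_point_point:
  assumes "x \<in> X" "y \<in> X"
  shows "graph_dist G (Inl x) (Inl y) = enat (if x = y then 0 else 2)"
proof (cases "x = y")
  case True
  then show ?thesis using graph_dist_self[of "Inl x"] assms by simp
next
  case False
  have "graph_dist G (Inl x) (Inl y) = enat 2"
  proof (rule graph_dist_parityI)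
    fix i :: nat
    assume "i < 2" "even i \<longleftrightarrow> even (2::nat)"
    then have "i = 0" by presburger
    then show "(Inl x, Inl y) \<notin> parcs G ^^ i" using False by simp
  qed (use points_relpow_2 assms in simp_all)
  then show ?thesis using False by simp
qed

lemma graph_dist_opposite_side:
  assumes "u \<in> pverts G" "(u, w) \<in> parcs G ^^ 3"
  shows "graph_dist G u w = enat (if (u, w) \<in> parcs G then 1 else 3)"
proof (cases "(u, w) \<in> parcs G")
  case True
  have "graph_dist G u w = enat 1"
    by (rule graph_dist_parityI) (use assms(1) True in simp_all)
  then show ?thesis using True by simp
next
  case False
  have "graph_dist G u w = enat 3"
    using assms
  proof (rule graph_dist_parityI)
    fix i :: nat
    assume "i < 3" "even i \<longleftrightarrow> even (3::nat)"
    then have "i = 1" by presburger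
    then show "(u, w) \<notin> parcs G ^^ i" using False by simp
  qed
  then show ?thesis using False by simp
qed

lemma graph_dist_incidence:
  assumes "x \<in> X" "l \<in> \<B>"
  shows "graph_dist G (Inl x) (Inr l) = enat (if x \<in> l then 1 else 3)"
    and "graph_dist G (Inr l) (Inl x) = enat (if x \<in> l then 1 else 3)"
proof -
  obtain y where y: "y \<in> l" "y \<in> X" using block_nonempty block_subset assms(2) by blast
  have "(Inl x, Inr l) \<in> parcs G ^^ (2 + 1)"
    by (rule relpow_trans[OF points_relpow_2[of x y]]) (use assms y in auto)
  then have "(Inl x, Inr l) \<in> parcs G ^^ 3" by (simp add: eval_nat_numeral)
  then show "graph_dist G (Inl x) (Inr l) = enat (if x \<in> l then 1 else 3)"
    using graph_dist_opposite_side[of "Inl x" "Inr l"] assms by simp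
  have "(Inr l, Inl x) \<in> parcs G ^^ (1 + 2)"
    by (rule relpow_trans[OF _ points_relpow_2[of y x]]) (use assms y in auto)
  then have "(Inr l, Inl x) \<in> parcs G ^^ 3" by (simp add: eval_nat_numeral)
  then show "graph_dist G (Inr l) (Inl x) = enat (if x \<in> l then 1 else 3)"
    using graph_dist_opposite_side[of "Inr l" "Inl x"] assms by simp
qed

lemma blocks_relpow_4:
  assumes "l \<in> \<B>" "m \<in> \<B>"
  shows "(Inr l, Inr m) \<in> parcs G ^^ 4"
proof -
  obtain x y where xy: "x \<in> l" "x \<in> X" "y \<in> m" "y \<in> X"
    using block_nonempty block_subset assms by (meson all_not_in_conv subsetD)
  have "(Inr l, Inl y) \<in> parcs G ^^ (1 + 2)"
    by (rule relpow_trans[OF _ points_relpow_2[of x y]]) (use assms xy in auto)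
  then have "(Inr l, Inr m) \<in> parcs G ^^ (1 + 2 + 1)"
    by (rule relpow_trans) (use assms xy in auto)
  then show ?thesis by (simp add: eval_nat_numeral)
qed

lemma graph_dist_block_block:
  assumes "l \<in> \<B>" "m \<in> \<B>"
  shows "graph_dist G (Inr l) (Inr m) = enat (if l = m then 0 else if l \<parallel> m then 4 else 2)"
proof -
  have meet: "(Inr l, Inr m) \<in> parcs G ^^ 2 \<longleftrightarrow> l \<inter> m \<noteq> {}"
    using assms by (auto simp: numeral_2_eq_2 relcomp_unfold split_sum_ex)
  consider (equal) "l = m" | (crossing) "l \<noteq> m" "\<not> l \<parallel> m" | (disjoint) "l \<noteq> m" "l \<inter> m = {}"
    by (auto simp: parallel_def)
  then show ?thesis
  proof cases
    case equal
    then show ?thesis using graph_dist_self[of "Inr l"] assms by simp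
  next
    case crossing
    have "graph_dist G (Inr l) (Inr m) = enat 2"
    proof (rule graph_dist_parityI)
      show "(Inr l, Inr m) \<in> parcs G ^^ 2"
        using meet crossing by (simp add: parallel_def)
      fix i :: nat
      assume "i < 2" "even i \<longleftrightarrow> even (2::nat)"
      then have "i = 0" by presburger
      then show "(Inr l, Inr m) \<notin> parcs G ^^ i" using crossing by simp
    qed (use assms in simp)
    then show ?thesis using crossing by simp
  next
    case disjoint
    have "graph_dist G (Inr l) (Inr m) = enat 4"
    proof (rule graph_dist_parityI)
      show "(Inr l, Inr m) \<in> parcs G ^^ 4" by (rule blocks_relpow_4[OF assms])
      fix i :: nat
      assume "i < 4" "even i \<longleftrightarrow> even (4::nat)"
      then have "i = 0 \<or> i = 2" by presburger
      then show "(Inr l, Inr m) \<notin> parcs G ^^ i" using meet disjoint by auto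
    qed (use assms in simp)
    then show ?thesis using disjoint by (simp add: parallel_def)
  qed
qed

section \<open>Probing points and blocks\<close>

lemma closed_nbhd_points:
  "S \<subseteq> X \<Longrightarrow> closed_nbhd G (Inl ` S) = Inl ` S \<union> Inr ` {l \<in> \<B>. l \<inter> S \<noteq> {}}"
  by (auto simp: closed_nbhd_def incidence_graph_def)

lemma closed_nbhd_blocks:
  assumes "T \<subseteq> \<B>"
  shows "closed_nbhd G (Inr ` T) = Inl ` \<Union>T \<union> Inr ` T"
proof (intro set_eqI)
  show "u \<in> closed_nbhd G (Inr ` T) \<longleftrightarrow> u \<in> Inl ` \<Union>T \<union> Inr ` T" for u
    using assms by (cases u) (auto simp: closed_nbhd_def)
qed

lemma closed_nbhd_pverts: "closed_nbhd G (pverts G) = Inl ` X \<union> Inr ` \<B>"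
  by (auto simp: closed_nbhd_def incidence_graph_def)

definition unresolved_points :: "'a set \<Rightarrow> 'a set set \<Rightarrow> 'a \<Rightarrow> 'a set" where
  "unresolved_points D N x = {y \<in> X. (\<forall>d\<in>D. y = d \<longleftrightarrow> x = d) \<and> (\<forall>n\<in>N. y \<in> n \<longleftrightarrow> x \<in> n)}"

definition unresolved_blocks :: "'a set \<Rightarrow> 'a set set \<Rightarrow> 'a set \<Rightarrow> 'a set set" where
  "unresolved_blocks D N l = {m \<in> \<B>. (\<forall>d\<in>D. d \<in> m \<longleftrightarrow> d \<in> l) \<and>
     (\<forall>n\<in>N. (m = n \<longleftrightarrow> l = n) \<and> (n \<parallel> m \<longleftrightarrow> n \<parallel> l))}"

lemma graph_dist_points_eq_iff:
  assumes "x \<in> X" "y \<in> X"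
  shows "d \<in> X \<Longrightarrow> graph_dist G (Inl d) (Inl y) = graph_dist G (Inl d) (Inl x) \<longleftrightarrow> (y = d \<longleftrightarrow> x = d)"
    and "n \<in> \<B> \<Longrightarrow> graph_dist G (Inr n) (Inl y) = graph_dist G (Inr n) (Inl x) \<longleftrightarrow> (y \<in> n \<longleftrightarrow> x \<in> n)"
  using assms by (auto simp: graph_dist_point_point graph_dist_incidence)

lemma graph_dist_blocks_eq_iff:
  assumes "l \<in> \<B>" "m \<in> \<B>"
  shows "d \<in> X \<Longrightarrow> graph_dist G (Inl d) (Inr m) = graph_dist G (Inl d) (Inr l) \<longleftrightarrow> (d \<in> m \<longleftrightarrow> d \<in> l)"
    and "n \<in> \<B> \<Longrightarrow> graph_dist G (Inr n) (Inr m) = graph_dist G (Inr n) (Inr l) \<longleftrightarrow>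
      (m = n \<longleftrightarrow> l = n) \<and> (n \<parallel> m \<longleftrightarrow> n \<parallel> l)"
  using assms by (auto simp: graph_dist_incidence graph_dist_block_block)

lemma graph_dist_point_neq_block:
  assumes "c \<in> pverts G" "x \<in> X" "l \<in> \<B>"
  shows "graph_dist G c (Inl x) \<noteq> graph_dist G c (Inr l)"
  using assms by (cases c) (simp_all add: graph_dist_point_point graph_dist_incidence
      graph_dist_block_block)

lemma pverts_Int_unresolved_Inl:
  assumes "x \<in> X" "D \<subseteq> X" "N \<subseteq> \<B>" "D \<noteq> {} \<or> N \<noteq> {}"
  shows "pverts G \<inter> unresolved G (Inl ` D \<union> Inr ` N) (Inl x) = Inl ` unresolved_points D N x"
proof (intro set_eqI)
  obtain c where c: "c \<in> Inl ` D \<union> Inr ` N" "c \<in> pverts G" using assms(2-4) by fastforce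
  show "u \<in> pverts G \<inter> unresolved G (Inl ` D \<union> Inr ` N) (Inl x) \<longleftrightarrow>
      u \<in> Inl ` unresolved_points D N x" for u
  proof (cases u)
    case (Inl y)
    then show ?thesis
      using assms(1) subsetD[OF assms(2)] subsetD[OF assms(3)]
      by (auto simp: unresolved_def unresolved_points_def ball_Un image_iff
          graph_dist_points_eq_iff[OF assms(1)])
  next
    case (Inr l)
    then show ?thesis
      using c graph_dist_point_neq_block[OF c(2) assms(1), of l] by (auto simp: unresolved_def)
  qed
qed

lemma pverts_Int_unresolved_Inr:
  assumes "l \<in> \<B>" "D \<subseteq> X" "N \<subseteq> \<B>" "D \<noteq> {} \<or> N \<noteq> {}"
  shows "pverts G \<inter> unresolved G (Inl ` D \<union> Inr ` N) (Inr l) = Inr ` unresolved_blocks D N l"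
proof (intro set_eqI)
  obtain c where c: "c \<in> Inl ` D \<union> Inr ` N" "c \<in> pverts G" using assms(2-4) by fastforce
  show "u \<in> pverts G \<inter> unresolved G (Inl ` D \<union> Inr ` N) (Inr l) \<longleftrightarrow>
      u \<in> Inr ` unresolved_blocks D N l" for u
  proof (cases u)
    case (Inr m)
    then show ?thesis
      using assms(1) subsetD[OF assms(2)] subsetD[OF assms(3)]
      by (auto simp: unresolved_def unresolved_blocks_def ball_Un image_iff
          graph_dist_blocks_eq_iff[OF assms(1)])
  next
    case (Inl x)
    then show ?thesis
      using c graph_dist_point_neq_block[OF c(2) _ assms(1), of x] by (auto simp: unresolved_def)
  qed
qed

lemma cops_win_probe_points_blocks:
  assumes fin: "finite D" "finite N" and sub: "D \<subseteq> X" "N \<subseteq> \<B>" and ne: "D \<noteq> {} \<or> N \<noteq> {}"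
    and card: "card D + card N \<le> m"
    and nbhd: "closed_nbhd G R = Inl ` S \<union> Inr ` T" "S \<subseteq> X" "T \<subseteq> \<B>"
    and points: "\<And>x. x \<in> S \<Longrightarrow> cops_win G m (Inl ` (S \<inter> unresolved_points D N x))"
    and blocks: "\<And>l. l \<in> T \<Longrightarrow> cops_win G m (Inr ` (T \<inter> unresolved_blocks D N l))"
  shows "cops_win G m R"
proof (rule cops_win_probe_set[where C = "Inl ` D \<union> Inr ` N"])
  show "finite (Inl ` D \<union> Inr ` N)" using fin by simp
  show "Inl ` D \<union> Inr ` N \<noteq> {}" using ne by auto
  show "card (Inl ` D \<union> Inr ` N) \<le> m"
    using card fin by (subst card_Un_disjoint) (auto simp: card_image)
  show "Inl ` D \<union> Inr ` N \<subseteq> pverts G" using sub by auto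
next
  have pverts: "closed_nbhd G R \<subseteq> pverts G"
    using nbhd by auto
  let ?U = "unresolved G (Inl ` D \<union> Inr ` N)"
  fix u assume "u \<in> closed_nbhd G R"
  then consider (point) x where "u = Inl x" "x \<in> S" | (block) l where "u = Inr l" "l \<in> T"
    unfolding nbhd(1) by blast
  then show "cops_win G m (closed_nbhd G R \<inter> unresolved G (Inl ` D \<union> Inr ` N) u)"
  proof cases
    case point
    then have "x \<in> X" using nbhd(2) by blast
    have "closed_nbhd G R \<inter> ?U u = closed_nbhd G R \<inter> (pverts G \<inter> ?U (Inl x))"
      using pverts point(1) by blast
    also have "\<dots> = Inl ` (S \<inter> unresolved_points D N x)"
      unfolding pverts_Int_unresolved_Inl[OF \<open>x \<in> X\<close> sub ne] nbhd(1) by auto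
    finally show ?thesis using points[OF point(2)] by simp
  next
    case block
    then have "l \<in> \<B>" using nbhd(3) by blast
    have "closed_nbhd G R \<inter> ?U u = closed_nbhd G R \<inter> (pverts G \<inter> ?U (Inr l))"
      using pverts block(1) by blast
    also have "\<dots> = Inr ` (T \<inter> unresolved_blocks D N l)"
      unfolding pverts_Int_unresolved_Inr[OF \<open>l \<in> \<B>\<close> sub ne] nbhd(1) by auto
    finally show ?thesis using blocks[OF block(2)] by simp
  qed
qed

lemma cops_win_blocks_if_points:
  assumes M: "finite M" "M \<noteq> {}" "M \<subseteq> \<B>" "card M \<le> m" and T: "T \<subseteq> M"
    and win: "\<And>l. l \<in> T \<Longrightarrow> cops_win G m (Inl ` (l - \<Union>(M - {l})))"
  shows "cops_win G m (Inr ` T)"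
proof (rule cops_win_probe_points_blocks[where D = "{}" and N = M])
  show "closed_nbhd G (Inr ` T) = Inl ` \<Union>T \<union> Inr ` T"
    by (rule closed_nbhd_blocks) (use T M(3) in blast)
  show "\<Union>T \<subseteq> X" using T M(3) block_subset by blast
next
  fix x assume "x \<in> \<Union>T"
  then obtain l where l: "l \<in> T" "x \<in> l" by blast
  let ?U = "\<Union>T \<inter> unresolved_points {} M x"
  have on_l: "?U \<subseteq> l" using l T by (auto simp: unresolved_points_def)
  show "cops_win G m (Inl ` ?U)"
  proof (cases "\<exists>n\<in>M - {l}. x \<in> n")
    case True
    then obtain n where n: "n \<in> M" "n \<noteq> l" "x \<in> n" by blast
    have "y = x" if "y \<in> ?U" for y
    proof -
      have "y \<in> l" "y \<in> n" using on_l that n by (auto simp: unresolved_points_def)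
      then show ?thesis using join_unique[of l n y x] l n T M(3) by blast
    qed
    then have "Inl ` ?U \<subseteq> {Inl x}" by blast
    then show ?thesis by (rule cops_win.located)
  next
    case False
    then have "Inl ` ?U \<subseteq> Inl ` (l - \<Union>(M - {l}))"
      using on_l by (auto simp: unresolved_points_def)
    then show ?thesis by (rule cops_win_mono[OF win[OF l(1)]])
  qed
next
  fix l assume "l \<in> T"
  then have "Inr ` (T \<inter> unresolved_blocks {} M l) \<subseteq> {Inr l}"
    using T by (auto simp: unresolved_blocks_def)
  then show "cops_win G m (Inr ` (T \<inter> unresolved_blocks {} M l))"
    by (rule cops_win.located)
qed (use M T in auto)

end

section \<open>Affine planes\<close>

locale affine_plane = linear_space X \<B> for X :: "'a set" and \<B> :: "'a set set" +
  fixes k :: nat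
  assumes finite_points: "finite X"
    and card_block: "l \<in> \<B> \<Longrightarrow> card l = k"
    and card_blocks_through: "x \<in> X \<Longrightarrow> card {l \<in> \<B>. x \<in> l} = k + 1"
    and two_le_order: "2 \<le> k"
begin

lemma finite_blocks: "finite \<B>"
  using finite_points block_subset by (meson finite_Pow_iff finite_subset PowI subsetI)

lemma finite_block: "l \<in> \<B> \<Longrightarrow> finite l"
  using block_subset finite_points finite_subset by blast

lemma finite_pencil: "finite (pencil x)"
  using finite_blocks by (simp add: pencil_def)

lemma card_pencil: "x \<in> X \<Longrightarrow> card (pencil x) = k + 1"
  using card_blocks_through by (simp add: pencil_def)

lemma ex1_parallel:
  assumes l: "l \<in> \<B>" and x: "x \<in> X"
  shows "\<exists>!m. m \<in> pencil x \<and> l \<parallel> m"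
proof (cases "x \<in> l")
  case True
  then show ?thesis using l by (auto simp: pencil_def parallel_def)
next
  case False
  have "{m \<in> pencil x. l \<parallel> m} = pencil x - {m \<in> pencil x. \<not> l \<parallel> m}" by blast
  also have "card \<dots> = (k + 1) - k"
    using card_pencil_meeting[OF l x False] card_pencil[OF x] card_block[OF l] finite_pencil
    by (simp add: card_Diff_subset)
  finally have "card {m \<in> pencil x. l \<parallel> m} = 1" by simp
  then obtain n where "{m \<in> pencil x. l \<parallel> m} = {n}" by (auto simp: card_1_singleton_iff)
  then show ?thesis by (intro ex1I[of _ n]) auto
qed

definition parallel_through :: "'a set \<Rightarrow> 'a \<Rightarrow> 'a set" where
  "parallel_through l x = (THE m. m \<in> pencil x \<and> l \<parallel> m)"

lemma parallel_through:
  assumes "l \<in> \<B>" "x \<in> X"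
  shows "parallel_through l x \<in> pencil x" "l \<parallel> parallel_through l x"
  using theI'[OF ex1_parallel[OF assms]] by (simp_all add: parallel_through_def)

lemma parallel_through_eqI:
  assumes "l \<in> \<B>" "m \<in> pencil x" "l \<parallel> m"
  shows "parallel_through l x = m"
proof -
  have "x \<in> X" using assms(2) block_subset by (auto simp: pencil_def)
  then show ?thesis
    unfolding parallel_through_def using ex1_parallel[OF assms(1)] assms(2,3)
    by (intro the1_equality) auto
qed

lemma parallel_trans:
  assumes "l \<in> \<B>" "m \<in> \<B>" "n \<in> \<B>" "l \<parallel> m" "m \<parallel> n"
  shows "l \<parallel> n"
proof (cases "l \<inter> n = {}")
  case True
  then show ?thesis by (simp add: parallel_def)
next
  case False
  then obtain x where "l \<in> pencil x" "n \<in> pencil x" using assms by (auto simp: pencil_def)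
  then have "l = n"
    using parallel_through_eqI[OF assms(2)] parallel_sym[OF assms(4)] assms(5) by metis
  then show ?thesis by simp
qed

lemma parallel_class_parallel:
  assumes "l \<in> \<B>" "m \<in> parallel_class l" "n \<in> parallel_class l"
  shows "m \<parallel> n"
  using assms parallel_trans[of m l n] parallel_sym by (auto simp: parallel_class_def)

lemma not_parallel_parallel_class:
  assumes "l \<in> \<B>" "m \<in> \<B>" "\<not> m \<parallel> l" "n \<in> parallel_class l"
  shows "\<not> m \<parallel> n"
  using assms parallel_trans[of m n l] parallel_sym by (auto simp: parallel_class_def)

lemma card_parallel_class:
  assumes l: "l \<in> \<B>"
  shows "card (parallel_class l) = k"
proof -
  obtain x where x: "x \<in> l" using block_nonempty[OF l] by blast
  then have "card (pencil x) = k + 1" using card_pencil block_subset[OF l] by blast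
  then have "\<not> pencil x \<subseteq> {l}"
    using card_mono[of "{l}" "pencil x"] two_le_order by auto
  then obtain n where n: "n \<in> \<B>" "x \<in> n" "n \<noteq> l" by (auto simp: pencil_def)
  then have "\<not> n \<parallel> l" using x parallel_eqI[of n l x] by blast
  have "bij_betw (parallel_through l) n (parallel_class l)"
  proof (rule bij_betwI')
    have through: "parallel_through l y \<in> \<B>" "y \<in> parallel_through l y"
        "l \<parallel> parallel_through l y" if "y \<in> n" for y
      using parallel_through[OF l] that block_subset[OF n(1)] by (auto simp: pencil_def)
    show "parallel_through l y \<in> parallel_class l" if "y \<in> n" for y
      using through[OF that] by (simp add: parallel_class_def)
    show "parallel_through l y = parallel_through l z \<longleftrightarrow> y = z" if yz: "y \<in> n" "z \<in> n" for y z
    proof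
      assume "parallel_through l y = parallel_through l z"
      moreover have "parallel_through l y \<noteq> n"
        using through(3)[OF yz(1)] parallel_sym \<open>\<not> n \<parallel> l\<close> by metis
      ultimately show "y = z"
        using join_unique[of "parallel_through l y" n y z] through[OF yz(1)] through[OF yz(2)]
          yz n(1) by auto
    qed simp
    show "\<exists>y\<in>n. m = parallel_through l y" if m: "m \<in> parallel_class l" for m
    proof -
      obtain y where "y \<in> n" "y \<in> m"
        using not_parallel_parallel_class[OF l n(1) \<open>\<not> n \<parallel> l\<close> m] by (auto simp: parallel_def)
      then show ?thesis
        using parallel_through_eqI[OF l, of m y] m by (auto simp: parallel_class_def pencil_def)
    qed
  qed
  then show ?thesis using card_block[OF n(1)] bij_betw_same_card by fastforce
qed

lemma card_block_minus_parallels: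
  assumes "m \<in> \<B>" "N \<subseteq> \<B>" "pairwise (\<parallel>) N" "\<And>n. n \<in> N \<Longrightarrow> \<not> m \<parallel> n"
  shows "card (m - \<Union>N) = k - card N"
  using card_block_Int_Union_parallels[OF assms] card_block finite_block assms(1)
  by (simp add: card_Diff_subset_Int)

lemma card_pencil_minus_directions:
  assumes z: "z \<in> X" and N: "N \<subseteq> \<B>" "pairwise (\<lambda>n n'. \<not> n \<parallel> n') N"
  shows "card {m \<in> pencil z. \<forall>n\<in>N. \<not> n \<parallel> m} = k + 1 - card N"
proof -
  let ?f = "\<lambda>n. parallel_through n z"
  have f: "?f n \<in> \<B>" "?f n \<in> pencil z" "n \<parallel> ?f n" if "n \<in> N" for n
    using parallel_through[OF _ z] that N(1) by (auto simp: pencil_def)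
  have "inj_on ?f N"
  proof (rule inj_onI)
    fix n n' assume nn: "n \<in> N" "n' \<in> N" "?f n = ?f n'"
    then have "n \<parallel> n'"
      using parallel_trans[of n "?f n" n'] f[OF nn(1)] parallel_sym[OF f(3)[OF nn(2)]] N(1) by auto
    then show "n = n'" using N(2) nn(1,2) by (auto simp: pairwise_def)
  qed
  moreover have "{m \<in> pencil z. \<forall>n\<in>N. \<not> n \<parallel> m} = pencil z - ?f ` N"
  proof -
    have "m \<in> ?f ` N \<longleftrightarrow> (\<exists>n\<in>N. n \<parallel> m)" if "m \<in> pencil z" for m
      using f parallel_through_eqI that N(1) by blast
    then show ?thesis by blast
  qed
  moreover have "?f ` N \<subseteq> pencil z" using f by blast
  ultimately show ?thesis
    using card_pencil[OF z] finite_pencil[of z]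
    by (simp add: card_Diff_subset finite_subset card_image)
qed

lemma obtain_directions:
  assumes "q \<in> X" "n \<le> k + 1"
  obtains N where "N \<subseteq> \<B>" "card N = n" "pairwise (\<lambda>l m. \<not> l \<parallel> m) N"
proof -
  have "n \<le> card (pencil q)" using card_pencil assms by simp
  then obtain N where N: "N \<subseteq> pencil q" "card N = n"
    by (rule obtain_subset_with_card_n)
  then have "N \<subseteq> \<B>" by (auto simp: pencil_def)
  moreover have "pairwise (\<lambda>l m. \<not> l \<parallel> m) N"
    using N(1) pencil_not_parallel[of _ q] by (auto simp: pairwise_def)
  ultimately show thesis using that N(2) by blast
qed

lemma obtain_parallels_crossing_pencil:
  assumes z: "z \<in> X" and T: "T \<subseteq> pencil z" "card T \<le> k" and n: "n \<le> k"
  obtains N where "N \<subseteq> \<B>" "card N = n" "pairwise (\<parallel>) N"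
    "\<And>m l. m \<in> T \<Longrightarrow> l \<in> N \<Longrightarrow> \<not> m \<parallel> l"
proof -
  have "finite T" using T(1) finite_pencil by (rule finite_subset)
  then have "\<not> pencil z \<subseteq> T"
    using card_mono[of T "pencil z"] card_pencil[OF z] T(2) by auto
  then obtain l where l: "l \<in> pencil z" "l \<notin> T" by blast
  then have l_block: "l \<in> \<B>" by (simp add: pencil_def)
  then have "n \<le> card (parallel_class l)" using card_parallel_class n by simp
  then obtain N where N: "N \<subseteq> parallel_class l" "card N = n"
    by (rule obtain_subset_with_card_n)
  show thesis
  proof
    show "N \<subseteq> \<B>" using N(1) by (auto simp: parallel_class_def)
    show "pairwise (\<parallel>) N"
      using N(1) parallel_class_parallel[OF l_block] by (auto simp: pairwise_def)
    show "\<not> m \<parallel> l'" if "m \<in> T" "l' \<in> N" for m l'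
    proof (rule not_parallel_parallel_class[OF l_block])
      show "m \<in> \<B>" using that(1) T(1) by (auto simp: pencil_def)
      show "\<not> m \<parallel> l" using pencil_not_parallel[of m z l] that(1) T(1) l by blast
      show "l' \<in> parallel_class l" using that(2) N(1) by blast
    qed
  qed (rule N(2))
qed

section \<open>The cops' strategy\<close>

lemma unresolved_pencil_cases:
  assumes "N \<subseteq> \<B>" "m \<in> pencil z"
  shows "pencil z \<inter> unresolved_blocks D N m \<subseteq> {m} \<or>
    pencil z \<inter> unresolved_blocks D N m \<subseteq> {l \<in> pencil z. \<forall>n\<in>N. \<not> n \<parallel> l}"
proof (cases "\<exists>n\<in>N. n \<parallel> m")
  case True
  then obtain n where n: "n \<in> N" "n \<parallel> m" by blast
  have "l = m" if "l \<in> pencil z" "l \<in> unresolved_blocks D N m" for l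
  proof -
    have "n \<parallel> l" using that(2) n by (auto simp: unresolved_blocks_def)
    then show ?thesis
      using parallel_through_eqI[of n _ z] n assms that(1) by blast
  qed
  then show ?thesis by blast
next
  case False
  then show ?thesis by (auto simp: unresolved_blocks_def)
qed

lemma cops_win_points_if_pencils:
  assumes S: "S \<subseteq> X" "card S \<le> k"
    and win: "\<And>z T. z \<in> X \<Longrightarrow> T \<subseteq> pencil z \<Longrightarrow> card T \<le> card S \<Longrightarrow>
      cops_win G (k + 1) (Inr ` T)"
  shows "cops_win G (k + 1) (Inl ` S)"
proof (cases "S = {}")
  case False
  then obtain q where "q \<in> X" using S(1) by blast
  then obtain N where N: "N \<subseteq> \<B>" "card N = k + 1 - card S" "pairwise (\<lambda>l m. \<not> l \<parallel> m) N"
    by (rule obtain_directions[of q "k + 1 - card S"]) auto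
  let ?T = "{m \<in> \<B>. m \<inter> S \<noteq> {}}"
  show ?thesis
  proof (rule cops_win_probe_points_blocks[where D = S and N = N])
    show "finite S" "finite N"
      using finite_subset[OF S(1) finite_points] finite_subset[OF N(1) finite_blocks] by simp_all
    show "closed_nbhd G (Inl ` S) = Inl ` S \<union> Inr ` ?T"
      using S(1) by (rule closed_nbhd_points)
    show "card S + card N \<le> k + 1" using N(2) S(2) by simp
  next
    fix x assume "x \<in> S"
    then have "Inl ` (S \<inter> unresolved_points S N x) \<subseteq> {Inl x}"
      by (auto simp: unresolved_points_def)
    then show "cops_win G (k + 1) (Inl ` (S \<inter> unresolved_points S N x))"
      by (rule cops_win.located)
  next
    fix m assume "m \<in> ?T"
    then obtain z where m: "m \<in> \<B>" "z \<in> m" "z \<in> S" by blast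
    define T where "T = {l \<in> pencil z. \<forall>n\<in>N. \<not> n \<parallel> l}"
    have "z \<in> X" using m(3) S(1) by blast
    have "card T = card S"
      unfolding T_def card_pencil_minus_directions[OF \<open>z \<in> X\<close> N(1,3)] using N(2) S(2) by simp
    then have "cops_win G (k + 1) (Inr ` T)"
      by (intro win[OF \<open>z \<in> X\<close>]) (auto simp: T_def)
    moreover have "cops_win G (k + 1) (Inr ` {m})" by simp
    moreover have "?T \<inter> unresolved_blocks S N m \<subseteq> pencil z \<inter> unresolved_blocks S N m"
      using m by (auto simp: unresolved_blocks_def pencil_def)
    moreover have "m \<in> pencil z" using m by (simp add: pencil_def)
    ultimately show "cops_win G (k + 1) (Inr ` (?T \<inter> unresolved_blocks S N m))"
      using unresolved_pencil_cases[OF N(1), of m z S, folded T_def]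
      by (meson cops_win_mono image_mono subset_trans)
  qed (use S N(1) False in auto)
qed simp

lemma cops_win_pencil_if_points:
  assumes z: "z \<in> X" and T: "T \<subseteq> pencil z" "card T \<le> k"
    and win: "\<And>S. S \<subseteq> X \<Longrightarrow> card S < card T \<Longrightarrow> cops_win G (k + 1) (Inl ` S)"
  shows "cops_win G (k + 1) (Inr ` T)"
proof (cases "T = {}")
  case False
  have T_blocks: "T \<subseteq> \<B>" using T(1) by (auto simp: pencil_def)
  then have "finite T" using finite_blocks by (rule finite_subset)
  then have T_pos: "0 < card T" using False by (simp add: card_gt_0_iff)
  then have "k + 1 - card T \<le> k" by simp
  then obtain N where N: "N \<subseteq> \<B>" "card N = k + 1 - card T" "pairwise (\<parallel>) N"
    and crossing: "\<And>m n. m \<in> T \<Longrightarrow> n \<in> N \<Longrightarrow> \<not> m \<parallel> n"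
    using obtain_parallels_crossing_pencil[OF z T] by blast
  have "finite N" using N(1) finite_blocks by (rule finite_subset)
  show ?thesis
  proof (rule cops_win_blocks_if_points[where M = "T \<union> N"])
    show "card (T \<union> N) \<le> k + 1"
      using card_Un_le[of T N] N(2) T(2) by simp
    fix m assume m: "m \<in> T"
    then have "m \<in> \<B>" using T_blocks by blast
    then have "card (m - \<Union>N) = k - card N"
      using N(1,3) crossing[OF m] by (rule card_block_minus_parallels)
    also have "\<dots> < card T" using N(2) T(2) T_pos by simp
    finally have "cops_win G (k + 1) (Inl ` (m - \<Union>N))"
      using block_subset[OF \<open>m \<in> \<B>\<close>] by (intro win) auto
    moreover have "m \<notin> N" using crossing[OF m, of m] by auto
    then have "m - \<Union>(T \<union> N - {m}) \<subseteq> m - \<Union>N" by blast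
    ultimately show "cops_win G (k + 1) (Inl ` (m - \<Union>(T \<union> N - {m})))"
      by (metis cops_win_mono image_mono)
  qed (use False T_blocks N(1) \<open>finite T\<close> \<open>finite N\<close> in auto)
qed simp

lemma cops_win_points:
  assumes "S \<subseteq> X" "card S \<le> k"
  shows "cops_win G (k + 1) (Inl ` S)"
  using assms
proof (induction "card S" arbitrary: S rule: less_induct)
  case less
  show ?case
  proof (rule cops_win_points_if_pencils[OF less.prems])
    fix z T assume T: "z \<in> X" "T \<subseteq> pencil z" "card T \<le> card S"
    then have "card T \<le> k" using less.prems(2) by simp
    then show "cops_win G (k + 1) (Inr ` T)"
    proof (rule cops_win_pencil_if_points[OF T(1,2)])
      show "cops_win G (k + 1) (Inl ` S')" if "S' \<subseteq> X" "card S' < card T" for S'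
        using less.hyps[of S'] that T(3) less.prems(2) by simp
    qed
  qed
qed

lemma cops_win_block: "l \<in> \<B> \<Longrightarrow> cops_win G (k + 1) (Inl ` l)"
  using cops_win_points block_subset card_block by simp

lemma cops_win_parallel_class:
  assumes l: "l \<in> \<B>"
  shows "cops_win G (k + 1) (Inr ` parallel_class l)"
proof (rule cops_win_blocks_if_points[where M = "parallel_class l"])
  show "parallel_class l \<noteq> {}" using l by (auto simp: parallel_class_def)
  show "card (parallel_class l) \<le> k + 1" using card_parallel_class[OF l] by simp
  fix m assume "m \<in> parallel_class l"
  then have "m \<in> \<B>" by (simp add: parallel_class_def)
  then show "cops_win G (k + 1) (Inl ` (m - \<Union>(parallel_class l - {m})))"
    by (rule cops_win_mono[OF cops_win_block]) blast
qed (use finite_blocks in \<open>auto simp: parallel_class_def\<close>)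

lemma cops_win_probing_pencil:
  assumes q: "q \<in> X"
  shows "cops_win G (k + 1) (pverts G)"
proof (rule cops_win_probe_points_blocks[where D = "{}" and N = "pencil q"])
  show "{} \<noteq> {} \<or> pencil q \<noteq> {}" using card_pencil[OF q] by force
  show "card {} + card (pencil q) \<le> k + 1" using card_pencil[OF q] by simp
  show "pencil q \<subseteq> \<B>" by (auto simp: pencil_def)
  show "closed_nbhd G (pverts G) = Inl ` X \<union> Inr ` \<B>" by (rule closed_nbhd_pverts)
next
  fix x assume "x \<in> X"
  then obtain l where l: "l \<in> \<B>" "q \<in> l" "x \<in> l" using ex_join q by blast
  then have "X \<inter> unresolved_points {} (pencil q) x \<subseteq> l"
    by (auto simp: unresolved_points_def pencil_def)
  then show "cops_win G (k + 1) (Inl ` (X \<inter> unresolved_points {} (pencil q) x))"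
    by (intro cops_win_mono[OF cops_win_block[OF l(1)]] image_mono)
next
  fix m assume m: "m \<in> \<B>"
  define l where "l = parallel_through m q"
  have l: "l \<in> pencil q" "l \<parallel> m" "l \<in> \<B>"
    using parallel_through[OF m q] parallel_sym by (auto simp: l_def pencil_def)
  then have "\<B> \<inter> unresolved_blocks {} (pencil q) m \<subseteq> parallel_class l"
    by (auto simp: unresolved_blocks_def parallel_class_def)
  then show "cops_win G (k + 1) (Inr ` (\<B> \<inter> unresolved_blocks {} (pencil q) m))"
    by (intro cops_win_mono[OF cops_win_parallel_class[OF l(3)]] image_mono)
qed (use finite_pencil in auto)

lemma cops_win_pverts: "cops_win G (k + 1) (pverts G)"
proof (cases "X = {}")
  case True
  then have "\<B> = {}" using block_subset block_nonempty by blast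
  then show ?thesis using True by (simp add: incidence_graph_def)
next
  case False
  then show ?thesis using cops_win_probing_pencil by blast
qed

end

lemma affine_plane_if_bibd:
  assumes design: "bibd X \<B> v b (k + 1) k 1" and k: "2 \<le> k"
  shows "affine_plane X \<B> k"
proof
  have sub: "l \<subseteq> X" and card: "card l = k" if "l \<in> \<B>" for l
    using design that by (auto simp: bibd_def)
  have degree: "card {l \<in> \<B>. x \<in> l} = k + 1" if "x \<in> X" for x
    using design that by (simp add: bibd_def)
  have join: "\<exists>B. {l \<in> \<B>. x \<in> l \<and> y \<in> l} = {B}" if "x \<in> X" "y \<in> X" "x \<noteq> y" for x y
    using design that by (auto simp: bibd_def card_1_singleton_iff)
  show "l \<subseteq> X" "l \<noteq> {}" "card l = k" if "l \<in> \<B>" for l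
    using sub[OF that] card[OF that] k by auto
  show "\<exists>l\<in>\<B>. x \<in> l \<and> y \<in> l" if xy: "x \<in> X" "y \<in> X" for x y
  proof (cases "x = y")
    case True
    have "{l \<in> \<B>. x \<in> l} \<noteq> {}" using degree[OF xy(1)] by force
    then show ?thesis using True by blast
  next
    case False
    then show ?thesis using join[OF xy] by blast
  qed
  show "l = m" if "l \<in> \<B>" "m \<in> \<B>" "x \<in> l" "y \<in> l" "x \<in> m" "y \<in> m" "x \<noteq> y" for l m x y
  proof -
    have "x \<in> X" "y \<in> X" using sub that by auto
    then obtain B where "{l \<in> \<B>. x \<in> l \<and> y \<in> l} = {B}"
      using join \<open>x \<noteq> y\<close> by blast
    moreover have "l \<in> {l \<in> \<B>. x \<in> l \<and> y \<in> l}" "m \<in> {l \<in> \<B>. x \<in> l \<and> y \<in> l}"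
      using that by simp_all
    ultimately show ?thesis by simp
  qed
  show "card {l \<in> \<B>. x \<in> l} = k + 1" if "x \<in> X" for x by (rule degree[OF that])
qed (use assms in \<open>auto simp: bibd_def\<close>)

theorem theorem3p3:
  fixes X :: "'a set" and \<B> :: "'a set set" and v b r k :: nat
  assumes "bibd X \<B> v b r k 1" and "r = k + 1" and "k \<ge> 3"
  shows "localization_number (incidence_graph X \<B>) \<le> enat (k + 1)"
proof -
  interpret affine_plane X \<B> k
    by (rule affine_plane_if_bibd) (use assms in auto)
  show ?thesis
    using cops_win_pverts by (rule localization_number_le_if_cops_win)
qed

end
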